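(* Let $n$ be divisible by $4$. Interpret each $4\times 4$ (respectively $4\times 1$) array below as an $n\times n$ matrix (respectively a vector in $\mathbb{R}^n$) by replacing each entry $c$ with the block $cJ_{n/4\times n/4}$ (respectively $cJ_{n/4\times1}$). Let $$M^\star=\begin{pmatrix}1&1\\1&1\\1&-1\\1&-1\end{pmatrix}\begin{pmatrix}4&0\\0&1\end{pmatrix}\begin{pmatrix}1&1&1&1\\1&1&-1&-1\end{pmatrix},\qquad W=\begin{pmatrix}2&1&2&1\\1&2&1&2\\2&1&2&1\\1&2&1&2\end{pmatrix}.$$ Then the top two singular vectors of the entrywise product $W*M^\star$ are, up to normalization, $(1,1,1,1)$ and $(1,-1,1,-1)$. The (largest) principal angle between the subspace they span and the column span of $M^\star$ is $90$ degrees.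
   Context: $J_{a\times b}$ is the $a\times b$ all-ones matrix; $(W*M)_{i,j}=W_{i,j}M_{i,j}$ is the Hadamard product. In the definition of $M^\star$, the $4\times2$ factor is expanded row-blockwise and the $2\times4$ factor column-blockwise, each entry being repeated $n/4$ times, so that $M^\star$ is the $n\times n$ block expansion of the displayed $4\times4$ product. *)

theory Defs
  imports Complex_Main "Jordan_Normal_Form.VS_Connect"
begin

definition block_expand :: "nat \<Rightarrow> nat \<Rightarrow> real mat \<Rightarrow> real mat" where
  "block_expand p q A = mat (dim_row A * p) (dim_col A * q) (\<lambda>(i, j). A $$ (i div p, j div q))"

definition block_expand_vec :: "nat \<Rightarrow> real vec \<Rightarrow> real vec" where
  "block_expand_vec p v = vec (dim_vec v * p) (\<lambda>i. v $ (i div p))"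

definition hadamard :: "real mat \<Rightarrow> real mat \<Rightarrow> real mat" where
  "hadamard A B = mat (dim_row A) (dim_col A) (\<lambda>(i, j). A $$ (i, j) * B $$ (i, j))"

definition M_star :: "nat \<Rightarrow> real mat" where
  "M_star n =
     block_expand (n div 4) 1 (mat_of_rows_list 2 [[1, 1], [1, 1], [1, -1], [1, -1]])
     * mat_of_rows_list 2 [[4, 0], [0, 1]]
     * block_expand 1 (n div 4) (mat_of_rows_list 4 [[1, 1, 1, 1], [1, 1, -1, -1]])"

definition W_mat :: "nat \<Rightarrow> real mat" where
  "W_mat n = block_expand (n div 4) (n div 4)
     (mat_of_rows_list 4 [[2, 1, 2, 1], [1, 2, 1, 2], [2, 1, 2, 1], [1, 2, 1, 2]])"

text \<open>Full singular value decomposition of a real matrix \<open>A = U S V\<^sup>T\<close>, the singular values on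
  the diagonal of \<open>S\<close> being listed in nonincreasing order. The library predicate for orthogonal
  matrices only asks for pairwise orthogonal nonzero columns, hence the explicit conditions.\<close>

definition is_svd :: "real mat \<Rightarrow> real mat \<Rightarrow> real mat \<Rightarrow> real mat \<Rightarrow> bool" where
  "is_svd A U S V \<longleftrightarrow>
     U \<in> carrier_mat (dim_row A) (dim_row A) \<and> U\<^sup>T * U = 1\<^sub>m (dim_row A) \<and>
     V \<in> carrier_mat (dim_col A) (dim_col A) \<and> V\<^sup>T * V = 1\<^sub>m (dim_col A) \<and>
     S \<in> carrier_mat (dim_row A) (dim_col A) \<and> diagonal_mat S \<and>
     (\<forall>i < min (dim_row A) (dim_col A). 0 \<le> S $$ (i, i)) \<and>
     (\<forall>i j. i \<le> j \<longrightarrow> j < min (dim_row A) (dim_col A) \<longrightarrow> S $$ (j, j) \<le> S $$ (i, i)) \<and>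
     A = U * S * V\<^sup>T"

definition equal_up_to_normalization :: "real vec \<Rightarrow> real vec \<Rightarrow> bool" where
  "equal_up_to_normalization u x \<longleftrightarrow> (\<exists>c. c \<noteq> 0 \<and> u = c \<cdot>\<^sub>v x)"

text \<open>Principal angles of two subspaces in the recursive (Jordan, Bjorck-Golub) sense: the
  \<open>i\<close>-th pair of principal vectors maximises the inner product over unit vectors of the two
  subspaces that are orthogonal to the earlier principal vectors of the same subspace.
  Indices start at 0, and the angles come in nondecreasing order.\<close>

definition unit_orth_to :: "real vec set \<Rightarrow> (nat \<Rightarrow> real vec) \<Rightarrow> nat \<Rightarrow> real vec set" where
  "unit_orth_to E p i = {u \<in> E. u \<bullet> u = 1 \<and> (\<forall>j < i. u \<bullet> p j = 0)}"

definition principal_vectors ::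
  "real vec set \<Rightarrow> real vec set \<Rightarrow> nat \<Rightarrow> (nat \<Rightarrow> real vec) \<Rightarrow> (nat \<Rightarrow> real vec) \<Rightarrow> bool" where
  "principal_vectors E F k p q \<longleftrightarrow>
     (\<forall>i < k. p i \<in> unit_orth_to E p i \<and> q i \<in> unit_orth_to F q i \<and>
        (\<forall>u \<in> unit_orth_to E p i. \<forall>v \<in> unit_orth_to F q i. u \<bullet> v \<le> p i \<bullet> q i))"

text \<open>The principal vectors are not unique, but the angles do not depend on their choice.\<close>

definition principal_angle :: "real vec set \<Rightarrow> real vec set \<Rightarrow> nat \<Rightarrow> real" where
  "principal_angle E F i =
     (THE \<theta>. \<exists>p q. principal_vectors E F (Suc i) p q \<and> \<theta> = arccos (p i \<bullet> q i))"

definition subspace_dim :: "nat \<Rightarrow> real vec set \<Rightarrow> nat" where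
  "subspace_dim n E = vectorspace.dim class_ring ((module_vec TYPE(real) n)\<lparr>carrier := E\<rparr>)"

definition largest_principal_angle :: "nat \<Rightarrow> real vec set \<Rightarrow> real vec set \<Rightarrow> real" where
  "largest_principal_angle n E F =
     Max (principal_angle E F ` {..< min (subspace_dim n E) (subspace_dim n F)})"

abbreviation span_vec :: "nat \<Rightarrow> real vec set \<Rightarrow> real vec set" where
  "span_vec n \<equiv> LinearCombinations.module.span class_ring (module_vec TYPE(real) n)"

abbreviation column_span :: "real mat \<Rightarrow> real vec set" where
  "column_span A \<equiv> vec_space.col_space (dim_row A) A"

end

(* With m = n / 4, the matrix W * M_star is symmetric and equals the sum of lam a * f a (f a)^T,
   where the f a are the normalised block expansions of the four sign vectors (the characters of
   the Klein four-group) and lam = (24 m, 8 m, 6 m, 2 m). Since the nonzero eigenvalues are positive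
   and simple, every singular value decomposition must have multiples of f 0 and f 1 as its first two
   left and right singular vectors. The column span of M_star is spanned by f 0 and f 2, so the two
   planes share the line of f 0 and are otherwise orthogonal: the principal angles are 0 and pi / 2. *)

theory Submission
  imports Defs "Jordan_Normal_Form.DL_Rank"
begin

section \<open>Orthonormal families and their extension to orthonormal bases\<close>

text \<open>Values from index \<open>k\<close> on are left free, so that a family grows by function
  update and \<open>col U\<close> is an instance as it stands.\<close>

definition orthonormal :: "nat \<Rightarrow> nat \<Rightarrow> (nat \<Rightarrow> real vec) \<Rightarrow> bool" where
  "orthonormal n k f \<longleftrightarrow> (\<forall>a<k. f a \<in> carrier_vec n) \<and>
     (\<forall>a<k. \<forall>b<k. f a \<bullet> f b = (if a = b then 1 else 0))"

lemma orthonormal_carrier: "orthonormal n k f \<Longrightarrow> a < k \<Longrightarrow> f a \<in> carrier_vec n"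
  by (simp add: orthonormal_def)

lemma orthonormal_prod:
  "orthonormal n k f \<Longrightarrow> a < k \<Longrightarrow> b < k \<Longrightarrow> f a \<bullet> f b = (if a = b then 1 else 0)"
  by (simp add: orthonormal_def)

lemma scalar_prod_self_eq_0_iff:
  fixes v :: "real vec"
  assumes "v \<in> carrier_vec n"
  shows "v \<bullet> v = 0 \<longleftrightarrow> v = 0\<^sub>v n"
  using conjugate_square_eq_0_vec[OF assms] by simp

lemma vec_eq_if_diff_eq_0:
  fixes v w :: "'a :: group_add vec"
  assumes "v \<in> carrier_vec n" "w \<in> carrier_vec n" "v - w = 0\<^sub>v n"
  shows "v = w"
proof (rule eq_vecI)
  fix i assume "i < dim_vec w"
  then have "(v - w) $ i = 0"
    using assms by simp
  then show "v $ i = w $ i"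
    using \<open>i < dim_vec w\<close> by simp
qed (use assms in simp)

lemma scalar_prod_self_nonneg: "0 \<le> v \<bullet> (v :: real vec)"
  by (simp add: scalar_prod_def sum_nonneg)

text \<open>Padding the \<open>k\<close> vectors with zero rows gives a singular square matrix; a
  nonzero vector of its kernel is orthogonal to all of them and only needs normalising.\<close>

lemma orthonormal_extend_one:
  assumes f: "orthonormal n k f" and "k < n"
  shows "\<exists>v. orthonormal n (Suc k) (f(k := v))"
proof -
  define M where "M = mat_of_rows n (map (\<lambda>i. if i < k then f i else 0\<^sub>v n) [0..<n])"
  have M: "M \<in> carrier_mat n n"
    by (rule carrier_matI) (simp_all add: M_def)
  have row: "row M i = (if i < k then f i else 0\<^sub>v n)" if "i < n" for i
    using that f by (simp add: M_def orthonormal_carrier)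
  \<comment> \<open>Row \<open>k\<close> is zero, which puts a unit vector into the kernel of
    \<open>M\<^sup>T\<close>; the determinant carries singularity over to \<open>M\<close>.\<close>
  have "M\<^sup>T *\<^sub>v unit_vec n k = row M k"
    using M \<open>k < n\<close> by (intro eq_vecI) auto
  then have "M\<^sup>T *\<^sub>v unit_vec n k = 0\<^sub>v n"
    using row[OF \<open>k < n\<close>] by simp
  then have "det M\<^sup>T = 0"
    using det_0_iff_vec_prod_zero[of "M\<^sup>T" n] M \<open>k < n\<close>
    by (metis transpose_carrier_mat unit_vec_carrier unit_vec_nonzero)
  then obtain w where w: "w \<in> carrier_vec n" "w \<noteq> 0\<^sub>v n" "M *\<^sub>v w = 0\<^sub>v n"
    using det_0_iff_vec_prod_zero[OF M] det_transpose[OF M] by auto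
  have fw: "f a \<bullet> w = 0" if "a < k" for a
  proof -
    have "(M *\<^sub>v w) $ a = f a \<bullet> w"
      using that \<open>k < n\<close> M row[of a] by simp
    then show ?thesis
      using that \<open>k < n\<close> w(3) by simp
  qed
  have pos: "w \<bullet> w > 0"
    using w scalar_prod_self_eq_0_iff scalar_prod_self_nonneg[of w] by force
  define v where "v = (1 / sqrt (w \<bullet> w)) \<cdot>\<^sub>v w"
  have v: "v \<in> carrier_vec n" "v \<bullet> v = 1" "\<And>a. a < k \<Longrightarrow> f a \<bullet> v = 0" "\<And>a. a < k \<Longrightarrow> v \<bullet> f a = 0"
    using w pos fw orthonormal_carrier[OF f] comm_scalar_prod[OF w(1), of "f a" for a]
    by (auto simp: v_def)
  have "orthonormal n (Suc k) (f(k := v))"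
    using f v by (auto simp: orthonormal_def less_Suc_eq)
  then show ?thesis ..
qed

lemma orthonormal_extend:
  assumes "orthonormal n k f" and "k \<le> n"
  shows "\<exists>g. orthonormal n n g \<and> (\<forall>a<k. g a = f a)"
  using assms
proof (induction "n - k" arbitrary: k f)
  case 0
  then show ?case by auto
next
  case (Suc d)
  then obtain v where "orthonormal n (Suc k) (f(k := v))"
    using orthonormal_extend_one[of n k f] by (metis diff_is_0_eq' leI nat.distinct(1))
  moreover have "d = n - Suc k" "Suc k \<le> n"
    using Suc(2) by auto
  ultimately obtain g where "orthonormal n n g" "\<forall>a<Suc k. g a = (f(k := v)) a"
    using Suc(1) by blast
  then show ?case
    by (intro exI[of _ g]) auto
qed

text \<open>Translates between matrix equations such as \<open>A * V = U * S\<close> and equations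
  for single singular vectors.\<close>

lemma col_mult_diagonal:
  fixes U S :: "'a :: comm_ring_1 mat"
  assumes "U \<in> carrier_mat n n" "S \<in> carrier_mat n n" "diagonal_mat S" "i < n"
  shows "col (U * S) i = S $$ (i, i) \<cdot>\<^sub>v col U i"
proof (rule eq_vecI)
  fix j assume "j < dim_vec (S $$ (i, i) \<cdot>\<^sub>v col U i)"
  then have j: "j < n" using assms by simp
  have "col (U * S) i $ j = (\<Sum>l = 0..<n. U $$ (j, l) * S $$ (l, i))"
    using assms j by (simp add: scalar_prod_def)
  also have "\<dots> = (\<Sum>l = 0..<n. if l = i then U $$ (j, i) * S $$ (i, i) else 0)"
    using assms by (intro sum.cong) (auto simp: diagonal_mat_def)
  also have "\<dots> = (S $$ (i, i) \<cdot>\<^sub>v col U i) $ j"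
    using assms j by (simp add: mult.commute)
  finally show "col (U * S) i $ j = (S $$ (i, i) \<cdot>\<^sub>v col U i) $ j" .
qed (use assms in auto)

lemma orthonormal_cols:
  assumes "U \<in> carrier_mat n n" "U\<^sup>T * U = 1\<^sub>m n"
  shows "orthonormal n n (col U)"
proof -
  have "col U a \<bullet> col U b = (U\<^sup>T * U) $$ (a, b)" if "a < n" "b < n" for a b
    using assms(1) that by simp
  then show ?thesis
    using assms by (simp add: orthonormal_def)
qed

section \<open>Singular vectors of a positive semidefinite matrix with simple nonzero eigenvalues\<close>

text \<open>The spectral theorem in entrywise form, so that an instance can be checked block by
  block. Only the nonzero part of the spectrum is listed; strict decrease expresses simplicity and
  matches the order of the singular values.\<close>

locale spectral_decomposition =
  fixes n k :: nat and A :: "real mat" and f :: "nat \<Rightarrow> real vec" and lam :: "nat \<Rightarrow> real"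
  assumes A: "A \<in> carrier_mat n n"
    and k: "k \<le> n"
    and f: "orthonormal n k f"
    and entry: "\<And>i j. i < n \<Longrightarrow> j < n \<Longrightarrow> A $$ (i, j) = (\<Sum>a<k. lam a * f a $ i * f a $ j)"
    and lam_pos: "\<And>a. a < k \<Longrightarrow> lam a > 0"
    and lam_decreasing: "\<And>a b. a < b \<Longrightarrow> b < k \<Longrightarrow> lam b < lam a"
begin

lemma symmetric: "A\<^sup>T = A"
  using A by (intro eq_matI) (auto simp: entry mult_ac)

lemma mult_vec_index:
  assumes "w \<in> carrier_vec n" and "i < n"
  shows "(A *\<^sub>v w) $ i = (\<Sum>a<k. lam a * (f a \<bullet> w) * f a $ i)"
proof -
  have "(A *\<^sub>v w) $ i = (\<Sum>j = 0..<n. \<Sum>a<k. lam a * f a $ i * f a $ j * w $ j)"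
    using assms A by (simp add: scalar_prod_def entry sum_distrib_right)
  also have "\<dots> = (\<Sum>a<k. \<Sum>j = 0..<n. lam a * f a $ i * f a $ j * w $ j)"
    by (rule sum.swap)
  also have "\<dots> = (\<Sum>a<k. lam a * (f a \<bullet> w) * f a $ i)"
    using assms by (intro sum.cong) (auto simp: scalar_prod_def sum_distrib_left mult_ac)
  finally show ?thesis .
qed

lemma eigenvector:
  assumes "b < k"
  shows "A *\<^sub>v f b = lam b \<cdot>\<^sub>v f b"
proof (rule eq_vecI)
  fix i assume "i < dim_vec (lam b \<cdot>\<^sub>v f b)"
  then have i: "i < n"
    using orthonormal_carrier[OF f assms] by simp
  have "(A *\<^sub>v f b) $ i = (\<Sum>a<k. if a = b then lam b * f b $ i else 0)"
    unfolding mult_vec_index[OF orthonormal_carrier[OF f assms] i]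
    by (intro sum.cong) (auto simp: orthonormal_prod[OF f _ assms])
  also have "\<dots> = (lam b \<cdot>\<^sub>v f b) $ i"
    using assms i orthonormal_carrier[OF f assms] by simp
  finally show "(A *\<^sub>v f b) $ i = (lam b \<cdot>\<^sub>v f b) $ i" .
qed (use A orthonormal_carrier[OF f assms] in auto)

lemma kernel:
  assumes "w \<in> carrier_vec n" and "\<And>a. a < k \<Longrightarrow> f a \<bullet> w = 0"
  shows "A *\<^sub>v w = 0\<^sub>v n"
  using A assms by (intro eq_vecI) (auto simp del: index_mult_mat_vec simp: mult_vec_index)

text \<open>For a positive semidefinite matrix the left and right singular vectors can be taken
  equal: an orthonormal basis extending \<open>f\<close> serves as both, and the added vectors lie
  in the kernel.\<close>

lemma svd_exists: "\<exists>U S V. is_svd A U S V"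
proof -
  obtain g where g: "orthonormal n n g" and gf: "\<And>a. a < k \<Longrightarrow> g a = f a"
    using orthonormal_extend[OF f k] by auto
  define V where "V = mat_of_cols n (map g [0..<n])"
  define S where "S = mat n n (\<lambda>(i, j). if i = j \<and> i < k then lam i else 0)"
  have V: "V \<in> carrier_mat n n" and S: "S \<in> carrier_mat n n" and diag: "diagonal_mat S"
    by (auto simp: V_def S_def diagonal_mat_def)
  have col: "col V j = g j" if "j < n" for j
    using that g by (simp add: V_def orthonormal_carrier)
  have VV: "V\<^sup>T * V = 1\<^sub>m n"
    using V by (intro eq_matI) (auto simp: col orthonormal_prod[OF g])
  then have VV': "V * V\<^sup>T = 1\<^sub>m n"
    using V mat_mult_left_right_inverse[of "V\<^sup>T" n V] by simp
  have "A * V = V * S"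
  proof (rule mat_col_eqI)
    fix j assume "j < dim_col (V * S)"
    then have j: "j < n" using S by simp
    have "A *\<^sub>v g j = S $$ (j, j) \<cdot>\<^sub>v g j"
    proof (cases "j < k")
      case True
      then show ?thesis using j eigenvector[of j] by (simp add: gf S_def)
    next
      case False
      then have "f a \<bullet> g j = 0" if "a < k" for a
        using that j k gf[OF that] orthonormal_prod[OF g, of a j] by auto
      then have "A *\<^sub>v g j = 0\<^sub>v n"
        using j g by (intro kernel) (auto simp: orthonormal_carrier)
      then show ?thesis
        using False j orthonormal_carrier[OF g j] by (auto simp: S_def)
    qed
    then show "col (A * V) j = col (V * S) j"
      using col_mult2[OF A V j] col_mult_diagonal[OF V S diag j] col[OF j] by simp
  qed (use A V S in auto)
  then have "V * S * V\<^sup>T = A * (V * V\<^sup>T)"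
    using A V by (metis assoc_mult_mat transpose_carrier_mat)
  then have "A = V * S * V\<^sup>T"
    using VV' A by simp
  moreover have "S $$ (j, j) \<le> S $$ (i, i)" if "i \<le> j" "j < n" for i j
    using that lam_decreasing[of i j] lam_pos[of i] by (cases "i = j") (auto simp: S_def)
  moreover have "0 \<le> S $$ (i, i)" if "i < n" for i
    using that lam_pos[of i] by (auto simp: S_def)
  ultimately have "is_svd A V S V"
    using A V S VV diag by (auto simp: is_svd_def)
  then show ?thesis by blast
qed

section \<open>Constraints on an arbitrary singular value decomposition of \<open>A\<close>\<close>

context
  fixes U S V :: "real mat"
  assumes svd: "is_svd A U S V"
begin

lemma svd_facts:
  shows U: "U \<in> carrier_mat n n" and UU: "U\<^sup>T * U = 1\<^sub>m n"
    and V: "V \<in> carrier_mat n n" and VV: "V\<^sup>T * V = 1\<^sub>m n"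
    and S: "S \<in> carrier_mat n n" and diag: "diagonal_mat S"
    and decomp: "A = U * S * V\<^sup>T"
    and S_nonneg: "\<And>i. i < n \<Longrightarrow> 0 \<le> S $$ (i, i)"
    and S_decreasing: "\<And>i j. i \<le> j \<Longrightarrow> j < n \<Longrightarrow> S $$ (j, j) \<le> S $$ (i, i)"
  using svd unfolding is_svd_def carrier_matD[OF A] min.idem by blast+

lemma mult_col_V: "A *\<^sub>v col V i = S $$ (i, i) \<cdot>\<^sub>v col U i" if "i < n"
proof -
  have "A * V = U * S * (V\<^sup>T * V)"
    unfolding decomp using U S V by (intro assoc_mult_mat) auto
  then have "A * V = U * S"
    using VV U S by simp
  then show ?thesis
    using col_mult2[OF A V that] col_mult_diagonal[OF U S diag that] by simp
qed

text \<open>Since \<open>A\<close> and \<open>S\<close> are symmetric, transposing the decomposition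
  exchanges the roles of \<open>U\<close> and \<open>V\<close>.\<close>

lemma mult_col_U: "A *\<^sub>v col U i = S $$ (i, i) \<cdot>\<^sub>v col V i" if "i < n"
proof -
  have "S\<^sup>T = S"
    using S diag by (intro eq_matI) (auto simp: diagonal_mat_def, metis)
  have "A = (U * S * V\<^sup>T)\<^sup>T"
    using symmetric decomp by simp
  also have "\<dots> = V * (U * S)\<^sup>T"
    using U S V by (subst transpose_mult[of _ n n _ n]) auto
  also have "(U * S)\<^sup>T = S * U\<^sup>T"
    using U S \<open>S\<^sup>T = S\<close> by (subst transpose_mult[of _ n n _ n]) auto
  also have "V * (S * U\<^sup>T) = V * S * U\<^sup>T"
    using U S V by (intro assoc_mult_mat[symmetric]) auto
  finally have "A * U = V * S * U\<^sup>T * U"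
    by simp
  also have "\<dots> = V * S * (U\<^sup>T * U)"
    using U S V by (intro assoc_mult_mat) auto
  finally have "A * U = V * S * (U\<^sup>T * U)" .
  then have "A * U = V * S"
    using UU V S by simp
  then show ?thesis
    using col_mult2[OF A U that] col_mult_diagonal[OF V S diag that] by simp
qed

lemmas orthonormal_U = orthonormal_cols[OF U UU]
lemmas orthonormal_V = orthonormal_cols[OF V VV]

text \<open>Self-adjointness moves \<open>A\<close> onto its eigenvector.\<close>

lemma inner_eigenvector:
  assumes "a < k" "v \<in> carrier_vec n"
  shows "f a \<bullet> (A *\<^sub>v v) = lam a * (f a \<bullet> v)"
proof -
  have fa: "f a \<in> carrier_vec n"
    using orthonormal_carrier[OF f assms(1)] .
  have "f a \<bullet> (A *\<^sub>v v) = (A\<^sup>T *\<^sub>v f a) \<bullet> v"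
    using transpose_vec_mult_scalar[OF A assms(2) fa] by simp
  also have "\<dots> = lam a * (f a \<bullet> v)"
    using fa assms by (simp add: symmetric eigenvector)
  finally show ?thesis .
qed

lemma inner_V:
  assumes "a < k" "i < n"
  shows "lam a * (f a \<bullet> col V i) = S $$ (i, i) * (f a \<bullet> col U i)"
    and "lam a * (f a \<bullet> col U i) = S $$ (i, i) * (f a \<bullet> col V i)"
proof -
  have fa: "f a \<in> carrier_vec n"
    using orthonormal_carrier[OF f assms(1)] .
  have u: "col U i \<in> carrier_vec n" and v: "col V i \<in> carrier_vec n"
    using orthonormal_carrier[OF orthonormal_U assms(2)] orthonormal_carrier[OF orthonormal_V assms(2)] .
  show "lam a * (f a \<bullet> col V i) = S $$ (i, i) * (f a \<bullet> col U i)"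
    using inner_eigenvector[OF assms(1) v] scalar_prod_smult_distrib[OF fa u]
    unfolding mult_col_V[OF assms(2)] by metis
  show "lam a * (f a \<bullet> col U i) = S $$ (i, i) * (f a \<bullet> col V i)"
    using inner_eigenvector[OF assms(1) u] scalar_prod_smult_distrib[OF fa v]
    unfolding mult_col_U[OF assms(2)] by metis
qed

text \<open>Chaining the two relations of \<open>inner_V\<close> equates the squares once the
  nonzero inner product is cancelled; the signs rule out the negative root.\<close>

lemma singular_value_eq:
  assumes "a < k" "i < n" "f a \<bullet> col V i \<noteq> 0"
  shows "S $$ (i, i) = lam a"
proof -
  have "lam a * lam a * (f a \<bullet> col V i) = S $$ (i, i) * S $$ (i, i) * (f a \<bullet> col V i)"
    using inner_V[OF assms(1,2)] by (metis mult.assoc mult.left_commute)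
  then have "lam a * lam a = S $$ (i, i) * S $$ (i, i)"
    using assms(3) by simp
  then show ?thesis
    using lam_pos[OF assms(1)] S_nonneg[OF assms(2)] by (simp add: square_eq_iff)
qed

text \<open>Otherwise \<open>V\<^sup>T\<close> would kill \<open>f a\<close>, although it is
  invertible and \<open>f a\<close> has length one.\<close>

lemma exists_col_V:
  assumes "a < k"
  shows "\<exists>i<n. f a \<bullet> col V i \<noteq> 0"
proof (rule ccontr)
  assume *: "\<not> ?thesis"
  have fa: "f a \<in> carrier_vec n"
    using orthonormal_carrier[OF f assms(1)] .
  have "V\<^sup>T *\<^sub>v f a = 0\<^sub>v n"
    using * V fa comm_scalar_prod[OF fa, of "col V i" for i]
    by (intro eq_vecI) (auto simp: col_dim)
  moreover have "V * V\<^sup>T = 1\<^sub>m n"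
    using VV V mat_mult_left_right_inverse[of "V\<^sup>T" n V] by simp
  moreover have "V *\<^sub>v 0\<^sub>v n = 0\<^sub>v n"
    using V by (intro eq_vecI) auto
  ultimately have "f a = 0\<^sub>v n"
    using V fa assoc_mult_mat_vec[of V n n "V\<^sup>T" n "f a"] by simp
  then show False
    using orthonormal_prod[OF f assms assms] by simp
qed

text \<open>A column of \<open>V\<close> orthogonal to every \<open>f a\<close> lies in the kernel
  of \<open>A\<close>, which forces its singular value to be zero because \<open>col U i\<close> is
  a unit vector.\<close>

lemma exists_eigenvector:
  assumes "i < n" "S $$ (i, i) > 0"
  shows "\<exists>a<k. f a \<bullet> col V i \<noteq> 0"
proof (rule ccontr)
  assume "\<not> ?thesis"
  then have "S $$ (i, i) \<cdot>\<^sub>v col U i = 0\<^sub>v n"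
    using kernel[of "col V i"] mult_col_V[OF assms(1)]
      orthonormal_carrier[OF orthonormal_V assms(1)] by auto
  then have "S $$ (i, i) * (col U i \<bullet> col U i) = 0"
    using orthonormal_carrier[OF orthonormal_U assms(1)]
    by (metis scalar_prod_left_zero smult_scalar_prod_distrib)
  then show False
    using assms orthonormal_prod[OF orthonormal_U assms(1) assms(1)] by simp
qed

text \<open>The orthogonality hypotheses still allow \<open>col V i\<close> a kernel component.
  Applying \<open>A\<close> removes it and settles \<open>col U i\<close>; applying \<open>A\<close>
  to \<open>col U i\<close> then leads back to \<open>col V i\<close>.\<close>

lemma col_eqI:
  assumes "a < k" "i < n" "S $$ (i, i) = lam a"
    and orth: "\<And>b. b < k \<Longrightarrow> b \<noteq> a \<Longrightarrow> f b \<bullet> col V i = 0"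
  shows "col U i = (f a \<bullet> col V i) \<cdot>\<^sub>v f a" and "col V i = (f a \<bullet> col V i) \<cdot>\<^sub>v f a"
proof -
  define c where "c = f a \<bullet> col V i"
  note [simp] = orthonormal_carrier[OF f] orthonormal_carrier[OF orthonormal_U assms(2)]
    orthonormal_carrier[OF orthonormal_V assms(2)]
  have cancel: "v = w" if "lam a \<cdot>\<^sub>v v = lam a \<cdot>\<^sub>v w" for v w :: "real vec"
  proof -
    have "(1 / lam a) \<cdot>\<^sub>v (lam a \<cdot>\<^sub>v v) = (1 / lam a) \<cdot>\<^sub>v (lam a \<cdot>\<^sub>v w)"
      using that by simp
    then show ?thesis
      using lam_pos[OF assms(1)] by (simp add: smult_smult_assoc)
  qed
  have "A *\<^sub>v (col V i - c \<cdot>\<^sub>v f a) = 0\<^sub>v n"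
  proof (rule kernel)
    fix b assume "b < k"
    then show "f b \<bullet> (col V i - c \<cdot>\<^sub>v f a) = 0"
      using assms(1) orth[of b]
      by (auto simp: scalar_prod_minus_distrib[of _ n] scalar_prod_smult_distrib[of _ n]
          orthonormal_prod[OF f] c_def)
  qed (use assms(1) in simp)
  then have "A *\<^sub>v col V i - c \<cdot>\<^sub>v (A *\<^sub>v f a) = 0\<^sub>v n"
    using assms(1) A by (simp add: mult_minus_distrib_mat_vec[OF A] mult_mat_vec[OF A])
  then have "lam a \<cdot>\<^sub>v col U i - lam a \<cdot>\<^sub>v (c \<cdot>\<^sub>v f a) = 0\<^sub>v n"
    using assms by (simp add: mult_col_V eigenvector smult_smult_assoc mult.commute)
  from vec_eq_if_diff_eq_0[OF _ _ this] have "lam a \<cdot>\<^sub>v col U i = lam a \<cdot>\<^sub>v (c \<cdot>\<^sub>v f a)"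
    using assms(1) by simp
  then show U_eq: "col U i = (f a \<bullet> col V i) \<cdot>\<^sub>v f a"
    unfolding c_def by (rule cancel)
  have "lam a \<cdot>\<^sub>v col V i = A *\<^sub>v (c \<cdot>\<^sub>v f a)"
    unfolding c_def U_eq[symmetric] mult_col_U[OF assms(2)] assms(3) ..
  also have "\<dots> = lam a \<cdot>\<^sub>v (c \<cdot>\<^sub>v f a)"
    using assms(1) by (simp add: mult_mat_vec[OF A] eigenvector smult_smult_assoc mult.commute)
  finally show "col V i = (f a \<bullet> col V i) \<cdot>\<^sub>v f a"
    unfolding c_def by (rule cancel)
qed

text \<open>Strong induction: the eigenvector \<open>f j\<close> meets some column \<open>i\<close> of \<open>V\<close>, and \<open>i \<ge> j\<close> because the
  earlier singular values are already known, so \<open>S $$ (j, j) \<ge> lam j\<close>. Conversely column \<open>j\<close> meets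
  some \<open>f a\<close>, and \<open>a \<ge> j\<close> because it is orthogonal to the earlier columns.\<close>

lemma singular_vectors:
  assumes "j < k"
  shows "S $$ (j, j) = lam j \<and>
    (\<exists>c. c \<noteq> 0 \<and> col U j = c \<cdot>\<^sub>v f j \<and> col V j = c \<cdot>\<^sub>v f j)"
  using assms
proof (induction j rule: less_induct)
  case (less j)
  then have jn: "j < n" using k by simp
  have lam_inj: "a = b" if "lam a = lam b" "a < k" "b < k" for a b
    using that lam_decreasing[of a b] lam_decreasing[of b a] by (cases a b rule: linorder_cases) auto
  obtain i where i: "i < n" "f j \<bullet> col V i \<noteq> 0"
    using exists_col_V[OF less.prems] by auto
  then have Si: "S $$ (i, i) = lam j"
    using singular_value_eq less.prems by blast
  have "j \<le> i"
  proof (rule ccontr)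
    assume "\<not> j \<le> i"
    then have "lam i = lam j"
      using less.IH[of i] less.prems Si by simp
    then show False
      using lam_inj[of i j] \<open>\<not> j \<le> i\<close> less.prems by simp
  qed
  then have ge: "lam j \<le> S $$ (j, j)"
    using S_decreasing[of j i] i Si by simp
  have eq: "a = j" if a: "a < k" "f a \<bullet> col V j \<noteq> 0" for a
  proof (rule ccontr)
    assume "a \<noteq> j"
    have Sj: "S $$ (j, j) = lam a"
      using singular_value_eq[OF a(1) jn a(2)] .
    then have "a < j"
      using ge lam_decreasing[of j a] a(1) \<open>a \<noteq> j\<close> by (cases a j rule: linorder_cases) auto
    then obtain c where c: "c \<noteq> 0" "col V a = c \<cdot>\<^sub>v f a"
      using less.IH[of a] a(1) by auto
    have "col V a \<bullet> col V j = 0"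
      using orthonormal_prod[OF orthonormal_V _ jn, of a] \<open>a < j\<close> jn by simp
    then show False
      using c a orthonormal_carrier[OF f a(1)] orthonormal_carrier[OF orthonormal_V jn] by simp
  qed
  obtain a where "a < k" "f a \<bullet> col V j \<noteq> 0"
    using exists_eigenvector[OF jn] ge lam_pos[OF less.prems] by auto
  then have nz: "f j \<bullet> col V j \<noteq> 0"
    using eq[of a] by simp
  then have Sj: "S $$ (j, j) = lam j"
    using singular_value_eq[OF less.prems jn] by simp
  show ?case
    using Sj nz col_eqI[OF less.prems jn Sj] eq by blast
qed

end

end

section \<open>Principal angles of two planes with a common line\<close>

context vec_space
begin

text \<open>A list keeps the two coefficients apart even when \<open>a = b\<close>, which a linear
  combination over the set would not; hence the detour through \<open>span_list\<close>.\<close>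

lemma span_pair:
  assumes "a \<in> carrier_vec n" "b \<in> carrier_vec n"
  shows "span {a, b} = {s \<cdot>\<^sub>v a + t \<cdot>\<^sub>v b | s t. True}"
proof -
  have lc: "lincomb_list c [a, b] = c 0 \<cdot>\<^sub>v a + c 1 \<cdot>\<^sub>v b" for c
    using assms by simp
  have "span {a, b} = span_list [a, b]"
    using span_list_as_span[of "[a, b]"] assms by simp
  also have "\<dots> = {s \<cdot>\<^sub>v a + t \<cdot>\<^sub>v b | s t. True}"
  proof (intro equalityI subsetI)
    fix v assume "v \<in> {s \<cdot>\<^sub>v a + t \<cdot>\<^sub>v b | s t. True}"
    then obtain s t where "v = s \<cdot>\<^sub>v a + t \<cdot>\<^sub>v b" by auto
    then have "v = lincomb_list (\<lambda>i. if i = 0 then s else t) [a, b]"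
      unfolding lc by simp
    then show "v \<in> span_list [a, b]"
      unfolding span_list_def by blast
  qed (auto simp: span_list_def lc simp del: lincomb_list_Cons)
  finally show ?thesis .
qed

lemma span_eqI:
  assumes "S \<subseteq> carrier_vec n" "T \<subseteq> carrier_vec n" "S \<subseteq> span T" "T \<subseteq> span S"
  shows "span S = span T"
  using assms by (meson span_is_submodule span_is_subset subset_antisym)

end

text \<open>Pairing a vanishing combination with \<open>a\<close> and \<open>b\<close> shows
  independence; the dimension is then the rank of the matrix with these two columns.\<close>

lemma orthonormal_pair_dim:
  assumes "a \<in> carrier_vec n" "b \<in> carrier_vec n" "a \<bullet> a = 1" "b \<bullet> b = 1" "a \<bullet> b = 0"
  shows "subspace_dim n (span_vec n {a, b}) = 2"
proof -
  interpret vec_space "TYPE(real)" n .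
  have ba: "b \<bullet> a = 0"
    using assms comm_scalar_prod by metis
  have "a \<noteq> b"
    using assms by auto
  have "lin_indpt {a, b}"
  proof (rule finite_lin_indpt2)
    fix c assume "lincomb c {a, b} = 0\<^sub>v n"
    then have "c a \<cdot>\<^sub>v a + c b \<cdot>\<^sub>v b = 0\<^sub>v n"
      using assms \<open>a \<noteq> b\<close> lincomb_as_lincomb_list_distinct[of "[a, b]" c] by simp
    then have "a \<bullet> (c a \<cdot>\<^sub>v a + c b \<cdot>\<^sub>v b) = 0" "b \<bullet> (c a \<cdot>\<^sub>v a + c b \<cdot>\<^sub>v b) = 0"
      using assms by simp_all
    then show "\<forall>v\<in>{a, b}. c v = 0"
      using assms ba by (simp add: scalar_prod_add_distrib[of _ n])
  qed (use assms in auto)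
  moreover have "mat_of_cols n [a, b] \<in> carrier_mat n 2"
    by (rule carrier_matI) simp_all
  ultimately have "rank (mat_of_cols n [a, b]) = 2"
    using lin_indpt_full_rank[of "mat_of_cols n [a, b]" 2] assms \<open>a \<noteq> b\<close>
    by (simp add: cols_mat_of_cols)
  then show ?thesis
    using assms by (simp add: rank_def subspace_dim_def cols_mat_of_cols)
qed

lemma combination_prod:
  fixes a b c d :: "'a :: comm_ring_1 vec"
  assumes "a \<in> carrier_vec n" "b \<in> carrier_vec n" "c \<in> carrier_vec n" "d \<in> carrier_vec n"
  shows "(s \<cdot>\<^sub>v a + t \<cdot>\<^sub>v b) \<bullet> (s' \<cdot>\<^sub>v c + t' \<cdot>\<^sub>v d) =
    s * s' * (a \<bullet> c) + s * t' * (a \<bullet> d) + t * s' * (b \<bullet> c) + t * t' * (b \<bullet> d)"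
proof -
  have right: "w \<bullet> (s' \<cdot>\<^sub>v c + t' \<cdot>\<^sub>v d) = s' * (w \<bullet> c) + t' * (w \<bullet> d)" if "w \<in> carrier_vec n" for w
    using assms that by (simp add: scalar_prod_add_distrib[of _ n])
  have "(s \<cdot>\<^sub>v a + t \<cdot>\<^sub>v b) \<bullet> (s' \<cdot>\<^sub>v c + t' \<cdot>\<^sub>v d) =
      s * (a \<bullet> (s' \<cdot>\<^sub>v c + t' \<cdot>\<^sub>v d)) + t * (b \<bullet> (s' \<cdot>\<^sub>v c + t' \<cdot>\<^sub>v d))"
    using assms by (simp add: add_scalar_prod_distrib[of _ n])
  then show ?thesis
    unfolding right[OF assms(1)] right[OF assms(2)] by (simp only: distrib_left ac_simps)
qed

text \<open>Here \<open>e\<close> spans the common line, while \<open>a\<close> and \<open>b\<close>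
  are the remaining, mutually orthogonal directions of the two planes.\<close>

locale planes_common_line =
  fixes n :: nat and e a b :: "real vec"
  assumes carrier [simp]: "e \<in> carrier_vec n" "a \<in> carrier_vec n" "b \<in> carrier_vec n"
    and unit [simp]: "e \<bullet> e = 1" "a \<bullet> a = 1" "b \<bullet> b = 1"
    and orth [simp]: "e \<bullet> a = 0" "e \<bullet> b = 0" "a \<bullet> b = 0"
begin

abbreviation "E \<equiv> span_vec n {e, a}"
abbreviation "F \<equiv> span_vec n {e, b}"

lemma orth_sym [simp]: "a \<bullet> e = 0" "b \<bullet> e = 0" "b \<bullet> a = 0"
  using orth comm_scalar_prod carrier by metis+

lemma in_plane_iff:
  assumes "c \<in> carrier_vec n"
  shows "u \<in> span_vec n {e, c} \<longleftrightarrow> (\<exists>s t. u = s \<cdot>\<^sub>v e + t \<cdot>\<^sub>v c)"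
  using vec_space.span_pair[of e n c] assms by auto

lemma dims: "subspace_dim n E = 2" "subspace_dim n F = 2"
  by (intro orthonormal_pair_dim; simp)+

lemma unit_vectors_in_planes:
  assumes u: "u \<in> E" "u \<bullet> u = 1" and v: "v \<in> F" "v \<bullet> v = 1"
  shows "u \<bullet> v \<le> 1" and "u \<bullet> v = 1 \<Longrightarrow> (\<exists>s t. s \<noteq> 0 \<and> t \<noteq> 0 \<and> u = s \<cdot>\<^sub>v e \<and> v = t \<cdot>\<^sub>v e)"
proof -
  obtain s t where st: "u = s \<cdot>\<^sub>v e + t \<cdot>\<^sub>v a" "s * s + t * t = 1"
    using u by (auto simp: in_plane_iff combination_prod[of _ n])
  obtain s' t' where st': "v = s' \<cdot>\<^sub>v e + t' \<cdot>\<^sub>v b" "s' * s' + t' * t' = 1"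
    using v by (auto simp: in_plane_iff combination_prod[of _ n])
  have uv: "u \<bullet> v = s * s'"
    by (simp add: st st' combination_prod[of _ n])
  \<comment> \<open>The right-hand side is the squared length of \<open>u - v\<close> in
    coordinates. As a sum of squares it gives the bound, and in the case of equality it makes
    \<open>t\<close> and \<open>t'\<close> vanish.\<close>
  have sum: "2 - 2 * (u \<bullet> v) = (s - s') * (s - s') + t * t + t' * t'"
    using st(2) st'(2) by (simp add: uv algebra_simps)
  have nonneg: "0 \<le> (s - s') * (s - s')" "0 \<le> t * t" "0 \<le> t' * t'"
    by simp_all
  show "u \<bullet> v \<le> 1"
    using sum nonneg by linarith
  assume "u \<bullet> v = 1"
  then have "t * t = 0" "t' * t' = 0"
    using sum nonneg by linarith+
  moreover from this have "s \<noteq> 0" "s' \<noteq> 0"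
    using st(2) st'(2) by auto
  moreover have "0 \<cdot>\<^sub>v a = 0\<^sub>v n" "0 \<cdot>\<^sub>v b = 0\<^sub>v n"
    by (auto intro!: eq_vecI simp: carrier_vecD[OF carrier(2)] carrier_vecD[OF carrier(3)])
  ultimately show "\<exists>s t. s \<noteq> 0 \<and> t \<noteq> 0 \<and> u = s \<cdot>\<^sub>v e \<and> v = t \<cdot>\<^sub>v e"
    using st(1) st'(1) by auto
qed

lemma spanning_vectors_in_planes: "e \<in> E" "a \<in> E" "e \<in> F" "b \<in> F"
proof -
  interpret vec_space "TYPE(real)" n .
  show "e \<in> E" "a \<in> E" "e \<in> F" "b \<in> F"
    by (auto intro!: span_mem)
qed

lemma first_pair:
  assumes "principal_vectors E F (Suc k) p q"
  shows "p 0 \<bullet> q 0 = 1"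
proof -
  from assms have
    *: "p 0 \<in> E" "p 0 \<bullet> p 0 = 1" "q 0 \<in> F" "q 0 \<bullet> q 0 = 1"
    "\<And>u v. u \<in> unit_orth_to E p 0 \<Longrightarrow> v \<in> unit_orth_to F q 0 \<Longrightarrow> u \<bullet> v \<le> p 0 \<bullet> q 0"
    by (auto simp: principal_vectors_def unit_orth_to_def)
  \<comment> \<open>The common vector \<open>e\<close> competes as a member of both planes, so the
    maximum is at least 1.\<close>
  from *(5)[of e e] have "1 \<le> p 0 \<bullet> q 0"
    using spanning_vectors_in_planes by (simp add: unit_orth_to_def)
  then show ?thesis
    using unit_vectors_in_planes(1)[OF *(1-4)] by simp
qed

text \<open>Once the first pair has used up the common line, one direction per plane is left. A
  generic \<open>c\<close> serves both planes, and \<open>r\<close> absorbs the scalar of the first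
  principal vector.\<close>

lemma orth_to_common_line:
  assumes "c \<in> carrier_vec n" "e \<bullet> c = 0" "u \<in> span_vec n {e, c}" "r \<noteq> 0" "u \<bullet> (r \<cdot>\<^sub>v e) = 0"
  shows "\<exists>t. u = t \<cdot>\<^sub>v c"
proof -
  obtain s t where st: "u = s \<cdot>\<^sub>v e + t \<cdot>\<^sub>v c"
    using assms in_plane_iff by auto
  have "c \<bullet> e = 0"
    using assms(1,2) comm_scalar_prod carrier(1) by metis
  then have "u \<bullet> (r \<cdot>\<^sub>v e) = s * r"
    unfolding st using assms(1,2) by (simp add: add_scalar_prod_distrib[of _ n])
  then have "s = 0"
    using assms by simp
  then have "u = t \<cdot>\<^sub>v c"
    unfolding st using assms(1) by (auto intro!: eq_vecI simp: carrier_vecD[OF carrier(1)])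
  then show ?thesis ..
qed

text \<open>Holds for every choice: the first pair consists of multiples of \<open>e\<close>, so the
  second pair can only be multiples of \<open>a\<close> and of \<open>b\<close>.\<close>

lemma second_pair:
  assumes "principal_vectors E F (Suc (Suc k)) p q"
  shows "p (Suc 0) \<bullet> q (Suc 0) = 0"
proof -
  from assms have
    "p 0 \<in> E" "p 0 \<bullet> p 0 = 1" "q 0 \<in> F" "q 0 \<bullet> q 0 = 1"
    and *: "p (Suc 0) \<in> E" "p (Suc 0) \<bullet> p 0 = 0" "q (Suc 0) \<in> F" "q (Suc 0) \<bullet> q 0 = 0"
    by (auto simp: principal_vectors_def unit_orth_to_def)
  then obtain s t where "s \<noteq> 0" "t \<noteq> 0" "p 0 = s \<cdot>\<^sub>v e" "q 0 = t \<cdot>\<^sub>v e"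
    using unit_vectors_in_planes(2) first_pair[OF assms] by blast
  then obtain s' t' where "p (Suc 0) = s' \<cdot>\<^sub>v a" "q (Suc 0) = t' \<cdot>\<^sub>v b"
    using orth_to_common_line[of a "p (Suc 0)" s] orth_to_common_line[of b "q (Suc 0)" t] * by force
  then show ?thesis
    by (simp add: smult_scalar_prod_distrib[of _ n] scalar_prod_smult_distrib[of _ n])
qed

text \<open>The angle is a definite description, so besides uniqueness of its value it takes one
  actual choice of principal vectors.\<close>

lemma principal_vectors_exist:
  "principal_vectors E F (Suc (Suc 0)) (\<lambda>i. if i = 0 then e else a) (\<lambda>i. if i = 0 then e else b)"
    (is "principal_vectors E F _ ?p ?q")
proof -
  have perp: "u \<bullet> v = 0" if "u \<in> E" "v \<in> F" "u \<bullet> e = 0" "v \<bullet> e = 0" for u v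
  proof -
    have "\<exists>s. u = s \<cdot>\<^sub>v a" "\<exists>t. v = t \<cdot>\<^sub>v b"
      using that orth_to_common_line[of a u 1] orth_to_common_line[of b v 1] by simp_all
    then obtain s t where "u = s \<cdot>\<^sub>v a" "v = t \<cdot>\<^sub>v b"
      by blast
    then show ?thesis
      by (simp add: smult_scalar_prod_distrib[of _ n] scalar_prod_smult_distrib[of _ n])
  qed
  have "?p i \<in> unit_orth_to E ?p i" "?q i \<in> unit_orth_to F ?q i" if "i < Suc (Suc 0)" for i
    using that spanning_vectors_in_planes by (auto simp: unit_orth_to_def less_Suc_eq)
  moreover have "u \<bullet> v \<le> ?p i \<bullet> ?q i"
    if "i < Suc (Suc 0)" "u \<in> unit_orth_to E ?p i" "v \<in> unit_orth_to F ?q i" for i u v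
  proof (cases "i = 0")
    case True
    then show ?thesis
      using unit_vectors_in_planes(1)[of u v] that by (simp add: unit_orth_to_def)
  next
    case False
    then have "u \<in> E" "v \<in> F" "u \<bullet> e = 0" "v \<bullet> e = 0"
      using that by (auto simp: unit_orth_to_def)
    then show ?thesis
      using False perp by simp
  qed
  ultimately show ?thesis
    by (simp add: principal_vectors_def)
qed

lemma principal_angle_0: "principal_angle E F 0 = 0"
  unfolding principal_angle_def
proof (rule the_equality)
  let ?p = "\<lambda>i :: nat. if i = 0 then e else a" and ?q = "\<lambda>i :: nat. if i = 0 then e else b"
  have "principal_vectors E F (Suc 0) ?p ?q"
    using principal_vectors_exist unfolding principal_vectors_def by blast
  then have "principal_vectors E F (Suc 0) ?p ?q \<and> 0 = arccos (?p 0 \<bullet> ?q 0)"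
    by simp
  then show "\<exists>p q. principal_vectors E F (Suc 0) p q \<and> 0 = arccos (p 0 \<bullet> q 0)"
    by blast
next
  fix \<theta> assume "\<exists>p q. principal_vectors E F (Suc 0) p q \<and> \<theta> = arccos (p 0 \<bullet> q 0)"
  then show "\<theta> = 0"
    using first_pair by force
qed

lemma principal_angle_1: "principal_angle E F (Suc 0) = pi / 2"
  unfolding principal_angle_def
proof (rule the_equality)
  let ?p = "\<lambda>i :: nat. if i = 0 then e else a" and ?q = "\<lambda>i :: nat. if i = 0 then e else b"
  have "principal_vectors E F (Suc (Suc 0)) ?p ?q \<and> pi / 2 = arccos (?p (Suc 0) \<bullet> ?q (Suc 0))"
    using principal_vectors_exist by simp
  then show "\<exists>p q. principal_vectors E F (Suc (Suc 0)) p q \<and> pi / 2 = arccos (p (Suc 0) \<bullet> q (Suc 0))"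
    by blast
next
  fix \<theta> assume "\<exists>p q. principal_vectors E F (Suc (Suc 0)) p q \<and> \<theta> = arccos (p (Suc 0) \<bullet> q (Suc 0))"
  then show "\<theta> = pi / 2"
    using second_pair by force
qed

lemma largest_angle: "largest_principal_angle n E F = pi / 2"
proof -
  have "{..<min (subspace_dim n E) (subspace_dim n F)} = {0, Suc 0}"
    unfolding dims by auto
  then show ?thesis
    by (simp add: largest_principal_angle_def principal_angle_0 principal_angle_1)
qed

end

section \<open>The block matrices\<close>

text \<open>Rows 0 and 1 are the vectors of the claim, rows 0 and 2 the columns of the 4 by 2 factor
  of \<open>M_star\<close>, and row 3 is the entrywise product of rows 1 and 2.\<close>

definition sign_table :: "nat \<Rightarrow> nat \<Rightarrow> real" where
  "sign_table a r = [[1, 1, 1, 1], [1, -1, 1, -1], [1, 1, -1, -1], [1, -1, -1, 1]] ! a ! r"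

definition sing_val :: "nat \<Rightarrow> nat \<Rightarrow> real" where
  "sing_val m a = [24, 8, 6, 2] ! a * real m"

text \<open>The divisor is the length of an expanded sign vector, which has \<open>4 * m\<close>
  entries \<plusminus>1.\<close>

definition sing_vec :: "nat \<Rightarrow> nat \<Rightarrow> real vec" where
  "sing_vec m a = vec (4 * m) (\<lambda>i. sign_table a (i div m) / sqrt (4 * real m))"

lemma less_4_cases: "(r :: nat) < 4 \<Longrightarrow> r = 0 \<or> r = 1 \<or> r = 2 \<or> r = 3"
  by auto

lemma sum_2: "(\<Sum>r = 0..<2. g r) = g 0 + g (1 :: nat)" for g :: "nat \<Rightarrow> real"
  by (simp add: numeral_2_eq_2)

lemma sum_4: "(\<Sum>r<4. g r) = g 0 + g 1 + g 2 + g (3 :: nat)" for g :: "nat \<Rightarrow> real"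
  by (simp add: eval_nat_numeral)

text \<open>Reduces inner products of expanded vectors to four-term sums over rows of
  \<open>sign_table\<close>.\<close>

lemma sum_blocks:
  "(\<Sum>i<k * m. g (i div m)) = real m * (\<Sum>r<k. g r)" for g :: "nat \<Rightarrow> real"
proof -
  have "(\<Sum>i<k * m. g (i div m)) = (\<Sum>r<k. \<Sum>i = r * m..<r * m + m. g (i div m))"
    by (rule sum.nat_group[symmetric])
  also have "\<dots> = (\<Sum>r<k. \<Sum>i = r * m..<r * m + m. g r)"
    by (intro sum.cong) (auto intro!: arg_cong[of _ _ g] div_nat_eqI simp: mult.commute)
  finally show ?thesis
    by (simp add: sum_distrib_left)
qed

lemma orthonormal_sing_vec:
  assumes "m > 0"
  shows "orthonormal (4 * m) 4 (sing_vec m)"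
proof -
  have "sing_vec m a \<bullet> sing_vec m b = (if a = b then 1 else 0)" if "a < 4" "b < 4" for a b
  proof -
    have "sing_vec m a \<bullet> sing_vec m b =
        (\<Sum>i<4 * m. sign_table a (i div m) * sign_table b (i div m) / (4 * real m))"
      by (simp add: sing_vec_def scalar_prod_def lessThan_atLeast0 real_sqrt_mult)
    also have "\<dots> = (\<Sum>r<4. sign_table a r * sign_table b r) / 4"
      using assms sum_blocks[where g = "\<lambda>r. sign_table a r * sign_table b r / (4 * real m)" and k = 4 and m = m]
      by (simp add: sum_divide_distrib[symmetric])
    also have "\<dots> = (if a = b then 1 else 0)"
      using less_4_cases[OF that(1)] less_4_cases[OF that(2)]
      unfolding sum_4 by (elim disjE; hypsubst; unfold sign_table_def; simp)
    finally show ?thesis .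
  qed
  then show ?thesis
    by (simp add: orthonormal_def sing_vec_def)
qed

lemma block_index: "i < k * m \<Longrightarrow> i div m < k" for i m k :: nat
  by (simp add: less_mult_imp_div_less)

section \<open>Entries of the block matrices and the spectral form of their entrywise
  product\<close>

lemma M_star_carrier: "M_star (4 * m) \<in> carrier_mat (4 * m) (4 * m)"
  by (auto simp: M_star_def block_expand_def mat_of_rows_list_def)

lemma M_star_index:
  assumes "i < 4 * m" "j < 4 * m"
  shows "M_star (4 * m) $$ (i, j) = 4 + sign_table 2 (i div m) * sign_table 2 (j div m)"
proof -
  \<comment> \<open>The nested sums mirror the bracketing of the triple product in
    \<open>M_star\<close>, so that the unfolded definition matches them.\<close>
  have entry: "(\<Sum>l = 0..<2. (\<Sum>k = 0..<2. [[1, 1], [1, 1], [1, -1], [1, -1]] ! r ! k * [[4, 0], [0, 1]] ! k ! l)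
      * [[1, 1, 1, 1], [1, 1, -1, -1]] ! l ! q) = 4 + sign_table 2 r * sign_table 2 q"
    if "r < 4" "q < 4" for r q :: nat
    using less_4_cases[OF that(1)] less_4_cases[OF that(2)] unfolding sum_2
    by (elim disjE; hypsubst; unfold sign_table_def; simp)
  show ?thesis
    unfolding entry[OF block_index[OF assms(1)] block_index[OF assms(2)], symmetric]
    using assms block_index[OF assms(1)] block_index[OF assms(2)]
    by (simp add: M_star_def block_expand_def mat_of_rows_list_def scalar_prod_def numeral_2_eq_2)
qed

lemma W_mat_carrier: "W_mat (4 * m) \<in> carrier_mat (4 * m) (4 * m)"
  by (auto simp: W_mat_def block_expand_def mat_of_rows_list_def)

lemma W_mat_index:
  assumes "i < 4 * m" "j < 4 * m"
  shows "W_mat (4 * m) $$ (i, j) =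
    [[2, 1, 2, 1], [1, 2, 1, 2], [2, 1, 2, 1], [1, 2, 1, 2]] ! (i div m) ! (j div m)"
  using assms block_index[OF assms(1)] block_index[OF assms(2)]
  by (simp add: W_mat_def block_expand_def mat_of_rows_list_def)

lemma hadamard_index:
  assumes "B \<in> carrier_mat nr nc" "i < nr" "j < nc"
  shows "hadamard B C $$ (i, j) = B $$ (i, j) * C $$ (i, j)"
  using assms by (simp add: hadamard_def)

text \<open>Write \<open>s1\<close>, \<open>s2\<close>, \<open>s3\<close> for the products of two
  signs from rows 1, 2, 3. The weight is \<open>3/2 + s1/2\<close>, and since
  \<open>s1 * s2 = s3\<close>, multiplying by \<open>4 + s2\<close> gives
  \<open>6 + 2 * s1 + 3/2 * s2 + 1/2 * s3\<close>.\<close>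

lemma base_entry:
  assumes "r < 4" "q < 4"
  shows "[[2, 1, 2, 1], [1, 2, 1, 2], [2, 1, 2, 1], [1, 2, 1, 2]] ! r ! q *
      (4 + sign_table 2 r * sign_table 2 q) =
      (\<Sum>a<4. [24, 8, 6, 2] ! a / 4 * sign_table a r * sign_table a q)"
  using less_4_cases[OF assms(1)] less_4_cases[OF assms(2)] unfolding sum_4
  by (elim disjE; hypsubst; unfold sign_table_def; simp)

lemma hadamard_spectral_decomposition:
  assumes "m > 0"
  shows "spectral_decomposition (4 * m) 4 (hadamard (W_mat (4 * m)) (M_star (4 * m))) (sing_vec m) (sing_val m)"
proof
  show "hadamard (W_mat (4 * m)) (M_star (4 * m)) \<in> carrier_mat (4 * m) (4 * m)"
    using W_mat_carrier[of m] by (auto simp: hadamard_def)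
  show "orthonormal (4 * m) 4 (sing_vec m)"
    using orthonormal_sing_vec[OF assms] .
next
  fix i j assume ij: "i < 4 * m" "j < 4 * m"
  have "hadamard (W_mat (4 * m)) (M_star (4 * m)) $$ (i, j) =
      [[2, 1, 2, 1], [1, 2, 1, 2], [2, 1, 2, 1], [1, 2, 1, 2]] ! (i div m) ! (j div m) *
      (4 + sign_table 2 (i div m) * sign_table 2 (j div m))"
    unfolding hadamard_index[OF W_mat_carrier ij] M_star_index[OF ij] W_mat_index[OF ij] ..
  also have "\<dots> = (\<Sum>a<4. [24, 8, 6, 2] ! a / 4 * sign_table a (i div m) * sign_table a (j div m))"
    by (rule base_entry[OF block_index[OF ij(1)] block_index[OF ij(2)]])
  \<comment> \<open>The two normalising factors contribute \<open>1 / (4 * m)\<close>, which cancels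
    the \<open>m\<close> in \<open>sing_val\<close> and leaves the quarter.\<close>
  also have "\<dots> = (\<Sum>a<4. sing_val m a * sing_vec m a $ i * sing_vec m a $ j)"
    using ij assms by (intro sum.cong) (auto simp: sing_val_def sing_vec_def field_simps real_sqrt_mult)
  finally show "hadamard (W_mat (4 * m)) (M_star (4 * m)) $$ (i, j) =
    (\<Sum>a<4. sing_val m a * sing_vec m a $ i * sing_vec m a $ j)" .
next
  fix a :: nat assume "a < 4"
  then show "sing_val m a > 0"
    using assms less_4_cases[of a] by (auto simp: sing_val_def)
next
  fix a b :: nat assume "a < b" "b < 4"
  then have "a < 4" by simp
  then show "sing_val m b < sing_val m a"
    using assms \<open>a < b\<close> less_4_cases[of a] less_4_cases[OF \<open>b < 4\<close>] by (auto simp: sing_val_def)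
qed (use assms in simp)

section \<open>The expanded vectors of the claim and the column span of
  \<open>M_star\<close>\<close>

lemma block_expand_sign_table:
  assumes "m > 0" "a < 4" "v = vec_of_list (map (sign_table a) [0..<4])"
  shows "block_expand_vec m v = sqrt (4 * real m) \<cdot>\<^sub>v sing_vec m a"
  using assms block_index[of _ 4 m]
  by (intro eq_vecI) (auto simp: block_expand_vec_def sing_vec_def vec_of_list_index)

lemma col_M_star:
  assumes "j < 4 * m"
  shows "col (M_star (4 * m)) j = (4 * sqrt (4 * real m)) \<cdot>\<^sub>v sing_vec m 0 +
    (sqrt (4 * real m) * sign_table 2 (j div m)) \<cdot>\<^sub>v sing_vec m 2"
proof (rule eq_vecI)
  fix i assume "i < dim_vec ((4 * sqrt (4 * real m)) \<cdot>\<^sub>v sing_vec m 0 +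
    (sqrt (4 * real m) * sign_table 2 (j div m)) \<cdot>\<^sub>v sing_vec m 2)"
  then have i: "i < 4 * m"
    by (simp add: sing_vec_def)
  have "sign_table 0 (i div m) = 1"
    using less_4_cases[OF block_index[OF i]] by (auto simp: sign_table_def)
  then show "col (M_star (4 * m)) j $ i = ((4 * sqrt (4 * real m)) \<cdot>\<^sub>v sing_vec m 0 +
    (sqrt (4 * real m) * sign_table 2 (j div m)) \<cdot>\<^sub>v sing_vec m 2) $ i"
    using M_star_carrier[of m] i assms by (simp add: M_star_index sing_vec_def)
qed (use M_star_carrier[of m] in \<open>simp add: sing_vec_def\<close>)

lemma column_span_M_star:
  assumes "m > 0"
  shows "column_span (M_star (4 * m)) = span_vec (4 * m) {sing_vec m 0, sing_vec m 2}"
proof -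
  interpret vec_space "TYPE(real)" "4 * m" .
  let ?C = "set (cols (M_star (4 * m)))"
  let ?c = "sqrt (4 * real m)"
  have f: "sing_vec m a \<in> carrier_vec (4 * m)" for a
    by (simp add: sing_vec_def)
  have dim: "dim_vec (sing_vec m a) = 4 * m" for a
    by (simp add: sing_vec_def)
  have c: "?c > 0"
    using assms by simp
  have C: "?C \<subseteq> carrier_vec (4 * m)"
    using M_star_carrier[of m] cols_dim[of "M_star (4 * m)"] by (metis carrier_matD(1))
  have mem: "col (M_star (4 * m)) j \<in> ?C" if "j < 4 * m" for j
    using that M_star_carrier[of m] by (metis carrier_matD(2) cols_length cols_nth nth_mem)
  \<comment> \<open>Columns \<open>0\<close> and \<open>3 * m\<close> come from the first and the
    last block, where row 2 of \<open>sign_table\<close> has opposite signs. Their sum and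
    difference, \<open>8 * ?c\<close> and \<open>2 * ?c\<close> times a basis vector, recover both
    basis vectors.\<close>
  define u where "u = col (M_star (4 * m)) 0"
  define v where "v = col (M_star (4 * m)) (3 * m)"
  have uv: "u \<in> ?C" "v \<in> ?C"
    unfolding u_def v_def using assms by (auto intro!: mem)
  have u: "u = (4 * ?c) \<cdot>\<^sub>v sing_vec m 0 + ?c \<cdot>\<^sub>v sing_vec m 2"
    and v: "v = (4 * ?c) \<cdot>\<^sub>v sing_vec m 0 + (- ?c) \<cdot>\<^sub>v sing_vec m 2"
    unfolding u_def v_def using assms by (simp_all add: col_M_star sign_table_def)
  have "sing_vec m 0 = (1 / (8 * ?c)) \<cdot>\<^sub>v u + (1 / (8 * ?c)) \<cdot>\<^sub>v v"
    unfolding u v using c by (intro eq_vecI) (simp_all add: dim field_simps)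
  moreover have "sing_vec m 2 = (1 / (2 * ?c)) \<cdot>\<^sub>v u + (- 1 / (2 * ?c)) \<cdot>\<^sub>v v"
    unfolding u v using c by (intro eq_vecI) (simp_all add: dim field_simps)
  ultimately have "{sing_vec m 0, sing_vec m 2} \<subseteq> span {u, v}"
    using span_pair[of u v] uv C by blast
  also have "\<dots> \<subseteq> span ?C"
    using uv by (intro span_is_monotone) auto
  finally have "{sing_vec m 0, sing_vec m 2} \<subseteq> span ?C" .
  moreover have "?C \<subseteq> span {sing_vec m 0, sing_vec m 2}"
  proof
    fix w assume "w \<in> ?C"
    then obtain j where "j < 4 * m" "w = col (M_star (4 * m)) j"
      using M_star_carrier[of m] by (metis carrier_matD(2) cols_length cols_nth in_set_conv_nth)
    then show "w \<in> span {sing_vec m 0, sing_vec m 2}"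
      using span_pair[OF f f] col_M_star by blast
  qed
  ultimately have "span ?C = span {sing_vec m 0, sing_vec m 2}"
    using f C by (intro span_eqI) auto
  then show ?thesis
    using M_star_carrier[of m] by (simp add: col_space_def)
qed

text \<open>Bridges the unnormalised vectors of the claim and the unit vectors required by
  \<open>planes_common_line\<close>.\<close>

lemma span_scaled_pair:
  assumes "a \<in> carrier_vec n" "b \<in> carrier_vec n" "(c :: real) \<noteq> 0"
  shows "span_vec n {c \<cdot>\<^sub>v a, c \<cdot>\<^sub>v b} = span_vec n {a, b}"
proof -
  interpret vec_space "TYPE(real)" n .
  have ca: "c \<cdot>\<^sub>v a \<in> carrier_vec n" and cb: "c \<cdot>\<^sub>v b \<in> carrier_vec n"
    using assms by simp_all
  have "c \<cdot>\<^sub>v a = c \<cdot>\<^sub>v a + 0 \<cdot>\<^sub>v b" "c \<cdot>\<^sub>v b = 0 \<cdot>\<^sub>v a + c \<cdot>\<^sub>v b"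
    using assms(1,2) by (auto intro!: eq_vecI)
  then have "{c \<cdot>\<^sub>v a, c \<cdot>\<^sub>v b} \<subseteq> span {a, b}"
    unfolding span_pair[OF assms(1,2)] by blast
  moreover have "a = (1 / c) \<cdot>\<^sub>v (c \<cdot>\<^sub>v a) + 0 \<cdot>\<^sub>v (c \<cdot>\<^sub>v b)"
    "b = 0 \<cdot>\<^sub>v (c \<cdot>\<^sub>v a) + (1 / c) \<cdot>\<^sub>v (c \<cdot>\<^sub>v b)"
    using assms by (auto intro!: eq_vecI)
  then have "{a, b} \<subseteq> span {c \<cdot>\<^sub>v a, c \<cdot>\<^sub>v b}"
    unfolding span_pair[OF ca cb] by blast
  ultimately show ?thesis
    using assms ca cb by (intro span_eqI) auto
qed

theorem lemmaA2:
  fixes n :: nat and x y :: "real vec" and A :: "real mat"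
  assumes "n > 0" and "4 dvd n"
  defines "x \<equiv> block_expand_vec (n div 4) (vec_of_list [1, 1, 1, 1])"
    and "y \<equiv> block_expand_vec (n div 4) (vec_of_list [1, -1, 1, -1])"
    and "A \<equiv> hadamard (W_mat n) (M_star n)"
  shows "(\<exists>U S V. is_svd A U S V) \<and>
    (\<forall>U S V. is_svd A U S V \<longrightarrow>
       equal_up_to_normalization (col U 0) x \<and> equal_up_to_normalization (col V 0) x \<and>
       equal_up_to_normalization (col U 1) y \<and> equal_up_to_normalization (col V 1) y) \<and>
    largest_principal_angle n (span_vec n {x, y}) (column_span (M_star n)) = pi / 2"
proof -
  obtain m where n: "n = 4 * m" and m: "m > 0"
    using assms(1,2) by (auto elim!: dvdE)
  interpret spectral_decomposition n 4 A "sing_vec m" "sing_val m"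
    unfolding A_def n by (rule hadamard_spectral_decomposition[OF m])
  let ?c = "sqrt (4 * real m)"
  have c: "?c \<noteq> 0"
    using m by simp
  have x: "x = ?c \<cdot>\<^sub>v sing_vec m 0" and y: "y = ?c \<cdot>\<^sub>v sing_vec m 1"
    unfolding x_def y_def n using m
    by (auto intro!: block_expand_sign_table arg_cong[of _ _ vec_of_list] simp: sign_table_def upt_rec)
  \<comment> \<open>The witness \<open>s / ?c\<close> undoes the factor \<open>?c\<close> by which
    \<open>x\<close> and \<open>y\<close> exceed the unit vectors.\<close>
  have eqn: "equal_up_to_normalization u (?c \<cdot>\<^sub>v f)" if "s \<noteq> 0" "u = s \<cdot>\<^sub>v f" for u f s
    unfolding equal_up_to_normalization_def using that c
    by (intro exI[of _ "s / ?c"]) (simp add: smult_smult_assoc)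
  have "equal_up_to_normalization (col U 0) x \<and> equal_up_to_normalization (col V 0) x \<and>
       equal_up_to_normalization (col U 1) y \<and> equal_up_to_normalization (col V 1) y"
    if "is_svd A U S V" for U S V
    using singular_vectors[OF that, of 0] singular_vectors[OF that, of 1] eqn unfolding x y by auto
  moreover have "largest_principal_angle n (span_vec n {x, y}) (column_span (M_star n)) = pi / 2"
  proof -
    \<comment> \<open>The singular plane adds index 1 to the common index 0, the column span adds
      index 2.\<close>
    interpret planes_common_line n "sing_vec m 0" "sing_vec m 1" "sing_vec m 2"
      using f by unfold_locales (simp_all add: orthonormal_def)
    show ?thesis
      using largest_angle column_span_M_star[OF m] span_scaled_pair[OF carrier(1,2) c]
      unfolding x y n by simp
  qed
  ultimately show ?thesis
    using svd_exists by blast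
qed

end
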